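(* Let $Q$ be a finite abelian group of order $q$, written as a direct product of cyclic groups $Q=C_{n_1}\times C_{n_2}\times\cdots\times C_{n_t}$. Then there is an explicit $q\times q$ complex matrix $P$, defined directly in terms of roots of unity and depending only on this expression of $Q$ as a product of cyclic groups, such that $P^{-1}BP$ is diagonal for every group ring matrix $B$ of $\mathbb{C}Q$. In particular $P$ is independent of the entries of $B$. The matrix $P$ is obtained by iterating the block Fourier construction over the cyclic factors. Moreover: (1) the diagonal entries of $P^{-1}BP$ are given in terms of the entries of the first row of $B$; (2) $P$ may be chosen (the iterated construction gives such a $P$) so that its entries are roots of unity and $PP^*=qI_q$; (3) when $P$ is labelled appropriately to the structure of $Q$ as a product of cyclic groups (that is, according to the listing of the elements of $Q$ used in forming the group ring matrices), the rows of $P$ give the characters and character table of $Q$.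
   Context: For a finite group $G$ of order $q$ with a fixed listing $x_1,\dots,x_q$ of its elements and $w=\sum_{x\in G}\alpha_x x\in\mathbb{C}G$, let $\sigma(w)$ be the $q\times q$ complex matrix whose $(i,j)$ entry is $\alpha_{x_i^{-1}x_j}$. A group ring matrix of $\mathbb{C}G$, relative to the listing, is a matrix of the form $\sigma(w)$ with $w\in\mathbb{C}G$. $P^*$ denotes the conjugate transpose of $P$, and $I_q$ the $q\times q$ identity matrix. Iterated block Fourier construction: for $C_{n_1}$ one takes the $n_1\times n_1$ Fourier matrix $(\omega^{ij})_{0\le i,j<n_1}$, with $\omega$ a primitive $n_1$-th root of unity. If $P'$ is the matrix already constructed for a product $K$ of cyclic groups, the matrix for $K\times C_k$ is the $k\times k$ block matrix whose $(i,j)$ block, $0\le i,j<k$, is $\omega^{ij}P'$, with $\omega$ a primitive $k$-th root of unity. Correspondingly, the elements of $K\times C_k$, with $C_k$ generated by $h$, are listed as the listing of $K$, followed by $h$ times it, then $h^2$ times it, and so on. The group ring matrices of $K\times C_k$ are then the block circulant matrices with first block row $K_1,K_2,\dots,K_k$, where the $K_i$ are group ring matrices of $K$. *)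

theory Defs
  imports
    "HOL-Algebra.Product_Groups"
    "HOL-Algebra.Multiplicative_Group"
    "Jordan_Normal_Form.Schur_Decomposition"
begin

section \<open>Cyclic decompositions and the induced listing of the elements\<close>

text \<open>
  \<open>Q\<close> is the internal direct product of the cyclic subgroups generated by \<open>h 1, \<dots>, h t\<close>,
  of orders \<open>n 1, \<dots>, n t\<close>. The cyclic factors are indexed from 1.
\<close>

definition cyclic_decomposition ::
  "('a, 'b) monoid_scheme \<Rightarrow> nat \<Rightarrow> (nat \<Rightarrow> nat) \<Rightarrow> (nat \<Rightarrow> 'a) \<Rightarrow> bool" where
  "cyclic_decomposition Q t n h \<longleftrightarrow>
     (\<forall>i\<in>{1..t}. h i \<in> carrier Q \<and> Coset.order (subgroup_generated Q {h i}) = n i) \<and>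
     (\<lambda>x. finprod Q x {1..t}) \<in> iso (product_group {1..t} (\<lambda>i. subgroup_generated Q {h i})) Q"

fun cyclic_listing ::
  "('a, 'b) monoid_scheme \<Rightarrow> (nat \<Rightarrow> nat) \<Rightarrow> (nat \<Rightarrow> 'a) \<Rightarrow> nat \<Rightarrow> 'a list" where
  "cyclic_listing Q n h 0 = [\<one>\<^bsub>Q\<^esub>]"
| "cyclic_listing Q n h (Suc 0) = map (\<lambda>j. h 1 [^]\<^bsub>Q\<^esub> j) [0..<n 1]"
| "cyclic_listing Q n h (Suc (Suc m)) =
     concat (map (\<lambda>j. map (\<lambda>x. h (m + 2) [^]\<^bsub>Q\<^esub> j \<otimes>\<^bsub>Q\<^esub> x) (cyclic_listing Q n h (Suc m)))
                 [0..<n (m + 2)])"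


section \<open>Group ring matrices\<close>

text \<open>An element of the group ring is given by its coefficient function; only the values on
  the carrier matter.\<close>

definition group_ring_mat ::
  "('a, 'b) monoid_scheme \<Rightarrow> 'a list \<Rightarrow> ('a \<Rightarrow> complex) \<Rightarrow> complex mat" where
  "group_ring_mat G xs \<alpha> =
     mat (length xs) (length xs) (\<lambda>(i, j). \<alpha> (inv\<^bsub>G\<^esub> (xs ! i) \<otimes>\<^bsub>G\<^esub> xs ! j))"

definition group_ring_matrices ::
  "('a, 'b) monoid_scheme \<Rightarrow> 'a list \<Rightarrow> complex mat set" where
  "group_ring_matrices G xs = range (group_ring_mat G xs)"


section \<open>The iterated block Fourier construction\<close>

definition primitive_root_of_unity :: "nat \<Rightarrow> complex \<Rightarrow> bool" where
  "primitive_root_of_unity k w \<longleftrightarrow> 0 < k \<and> w ^ k = 1 \<and> (\<forall>m. 0 < m \<and> m < k \<longrightarrow> w ^ m \<noteq> 1)"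

definition fourier_mat :: "nat \<Rightarrow> complex \<Rightarrow> complex mat" where
  "fourier_mat k w = mat k k (\<lambda>(i, j). w ^ (i * j))"

text \<open>The \<open>k \<times> k\<close> block matrix with \<open>(i, j)\<close> block \<open>w ^ (i * j) \<cdot>\<^sub>m P\<close>.\<close>

definition block_fourier_mat :: "nat \<Rightarrow> complex \<Rightarrow> complex mat \<Rightarrow> complex mat" where
  "block_fourier_mat k w P =
     mat (k * dim_row P) (k * dim_col P)
       (\<lambda>(a, b). w ^ ((a div dim_row P) * (b div dim_col P)) *
                  P $$ (a mod dim_row P, b mod dim_col P))"

fun iterated_fourier_mat :: "(nat \<Rightarrow> nat) \<Rightarrow> (nat \<Rightarrow> complex) \<Rightarrow> nat \<Rightarrow> complex mat" where
  "iterated_fourier_mat n w 0 = 1\<^sub>m 1"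
| "iterated_fourier_mat n w (Suc 0) = fourier_mat (n 1) (w 1)"
| "iterated_fourier_mat n w (Suc (Suc m)) =
     block_fourier_mat (n (m + 2)) (w (m + 2)) (iterated_fourier_mat n w (Suc m))"


section \<open>Characters and character tables\<close>

text \<open>Functions on a group are taken extensional on the carrier, so that they can be counted.\<close>

definition complex_units :: "complex monoid" where
  "complex_units = \<lparr>carrier = UNIV - {0}, monoid.mult = (*), one = 1\<rparr>"

definition linear_characters :: "('a, 'b) monoid_scheme \<Rightarrow> ('a \<Rightarrow> complex) set" where
  "linear_characters G = hom G complex_units \<inter> extensional (carrier G)"

definition matrix_representation ::
  "('a, 'b) monoid_scheme \<Rightarrow> nat \<Rightarrow> ('a \<Rightarrow> complex mat) \<Rightarrow> bool" where
  "matrix_representation G d \<rho> \<longleftrightarrow> \<rho> \<in> hom G (units_of (ring_mat TYPE(complex) d ()))"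

definition irreducible_representation ::
  "('a, 'b) monoid_scheme \<Rightarrow> nat \<Rightarrow> ('a \<Rightarrow> complex mat) \<Rightarrow> bool" where
  "irreducible_representation G d \<rho> \<longleftrightarrow>
     matrix_representation G d \<rho> \<and> 0 < d \<and>
     (\<forall>W. subspace class_ring W (module_vec TYPE(complex) d) \<and>
          (\<forall>x\<in>carrier G. \<forall>v\<in>W. \<rho> x *\<^sub>v v \<in> W) \<longrightarrow>
          W = {0\<^sub>v d} \<or> W = carrier_vec d)"

definition irreducible_characters :: "('a, 'b) monoid_scheme \<Rightarrow> ('a \<Rightarrow> complex) set" where
  "irreducible_characters G =
     {(\<lambda>x\<in>carrier G. \<Sum>i<d. \<rho> x $$ (i, i)) | d \<rho>. irreducible_representation G d \<rho>}"

definition conjugacy_class :: "('a, 'b) monoid_scheme \<Rightarrow> 'a \<Rightarrow> 'a set" where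
  "conjugacy_class G x = {g \<otimes>\<^bsub>G\<^esub> x \<otimes>\<^bsub>G\<^esub> inv\<^bsub>G\<^esub> g | g. g \<in> carrier G}"

text \<open>\<open>M\<close> is a character table of \<open>G\<close> whose columns are labelled by the list \<open>xs\<close> of
  representatives of the conjugacy classes.\<close>

definition is_character_table ::
  "('a, 'b) monoid_scheme \<Rightarrow> 'a list \<Rightarrow> complex mat \<Rightarrow> bool" where
  "is_character_table G xs M \<longleftrightarrow>
     set xs \<subseteq> carrier G \<and>
     bij_betw (\<lambda>j. conjugacy_class G (xs ! j)) {..<length xs} (conjugacy_class G ` carrier G) \<and>
     dim_col M = length xs \<and>
     (\<exists>\<chi>. bij_betw \<chi> {..<dim_row M} (irreducible_characters G) \<and>
          (\<forall>i<dim_row M. \<forall>j<dim_col M. M $$ (i, j) = \<chi> i (xs ! j)))"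

end

theory Submission
  imports Defs
begin

text \<open>
  Writing indices in mixed radix, with digits \<open>d i a\<close> for \<open>i = 1, \<dots>, t\<close>, the \<open>a\<close>-th listed element is
  \<open>\<Prod>i. h i ^ d i a\<close> and the \<open>(a, b)\<close> entry of the iterated Fourier matrix \<open>P\<close> is
  \<open>\<Prod>i. w i ^ (d i a * d i b)\<close>. So row \<open>a\<close> lists the values of the linear character sending each
  \<open>h i\<close> to \<open>w i ^ d i a\<close>, and every linear character arises in this way from exactly one row.
  Orthogonality of characters gives \<open>P P\<^sup>* = q I\<close>. As \<open>P\<close> is symmetric, its columns are characters
  too; for a character \<open>\<chi>\<close>, substituting \<open>x_k = x_i y\<close> in the sum over \<open>k\<close> of
  \<open>\<alpha>(x_i\<^sup>-\<^sup>1 x_k) \<chi>(x_k)\<close> shows that it is an eigenvector of every group ring matrix, with eigenvalue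
  the sum of \<open>\<alpha>(y) \<chi>(y)\<close> over \<open>y\<close>. Finally, an eigenspace of one operator of an irreducible
  representation of an abelian group is invariant under all of them, hence is everything, so the
  irreducible characters are the linear ones.
\<close>

section \<open>Irreducible representations of abelian groups\<close>

lemma subspace_module_vecI:
  fixes W :: "'k :: field vec set"
  assumes "W \<subseteq> carrier_vec d" "0\<^sub>v d \<in> W"
    and "\<And>u v. u \<in> W \<Longrightarrow> v \<in> W \<Longrightarrow> u + v \<in> W"
    and "\<And>c v. v \<in> W \<Longrightarrow> c \<cdot>\<^sub>v v \<in> W"
  shows "subspace class_ring W (module_vec TYPE('k) d)"
  unfolding subspace_def submodule_def
  using assms vec_vs vec_module by (auto simp: module_vec_simps)

text \<open>Over the complex numbers the characteristic polynomial splits into \<open>d\<close>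
  linear factors, and \<open>0 < d\<close> guarantees that there is at least one, hence a
  root.\<close>

lemma complex_eigenvector_exists:
  fixes A :: "complex mat"
  assumes A: "A \<in> carrier_mat d d" and "0 < d"
  obtains k v where "v \<in> carrier_vec d" "v \<noteq> 0\<^sub>v d" "A *\<^sub>v v = k \<cdot>\<^sub>v v"
proof -
  obtain as where as: "char_poly A = (\<Prod>a\<leftarrow>as. [:- a, 1:])" "length as = d"
    using char_poly_factorized[OF A] by blast
  then obtain k where "k \<in> set as"
    using \<open>0 < d\<close> by (cases as) auto
  then have "poly (char_poly A) k = 0"
    unfolding as(1) by (induction as) auto
  then have "eigenvalue A k"
    using eigenvalue_root_char_poly[OF A] by simp
  then show ?thesis
    using that A unfolding eigenvalue_def eigenvector_def by auto
qed

lemma matrix_representationD: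
  assumes "matrix_representation G d \<rho>"
  shows "x \<in> carrier G \<Longrightarrow> \<rho> x \<in> carrier_mat d d"
    and "x \<in> carrier G \<Longrightarrow> \<exists>B\<in>carrier_mat d d. B * \<rho> x = 1\<^sub>m d"
    and "x \<in> carrier G \<Longrightarrow> y \<in> carrier G \<Longrightarrow> \<rho> (x \<otimes>\<^bsub>G\<^esub> y) = \<rho> x * \<rho> y"
  using assms unfolding matrix_representation_def hom_def units_of_def Units_def
  by (auto simp: ring_mat_simps Pi_iff)

text \<open>Schur's lemma in the abelian case. An eigenspace \<open>W\<close> of
  \<open>\<rho> x\<close> is stable under every \<open>\<rho> y\<close>, because the two operators
  commute; as it contains a nonzero vector, irreducibility makes it the whole space.\<close>

lemma irreducible_representation_scalar:
  assumes G: "comm_group G" and irr: "irreducible_representation G d \<rho>" and x: "x \<in> carrier G"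
  shows "\<exists>k. \<forall>v\<in>carrier_vec d. \<rho> x *\<^sub>v v = k \<cdot>\<^sub>v v"
proof -
  interpret comm_group G by fact
  have rep: "matrix_representation G d \<rho>" and "0 < d"
    using irr unfolding irreducible_representation_def by auto
  note car = matrix_representationD(1)[OF rep]
  obtain k v where v: "v \<in> carrier_vec d" "v \<noteq> 0\<^sub>v d" "\<rho> x *\<^sub>v v = k \<cdot>\<^sub>v v"
    using complex_eigenvector_exists[OF car[OF x] \<open>0 < d\<close>] by blast
  define W where "W = {v \<in> carrier_vec d. \<rho> x *\<^sub>v v = k \<cdot>\<^sub>v v}"
  have "subspace class_ring W (module_vec TYPE(complex) d)"
  proof (rule subspace_module_vecI)
    show "0\<^sub>v d \<in> W"
      using car[OF x] by (auto simp: W_def intro!: eq_vecI)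
    show "u + v \<in> W" if "u \<in> W" "v \<in> W" for u v
      using that car[OF x] by (auto simp: W_def mult_add_distrib_mat_vec smult_add_distrib_vec)
    show "c \<cdot>\<^sub>v v \<in> W" if "v \<in> W" for c v
      using that car[OF x] by (auto simp: W_def mult_mat_vec smult_smult_assoc mult.commute)
  qed (auto simp: W_def)
  moreover have "\<rho> y *\<^sub>v u \<in> W" if y: "y \<in> carrier G" and u: "u \<in> W" for y u
  proof -
    have uc: "u \<in> carrier_vec d" and ue: "\<rho> x *\<^sub>v u = k \<cdot>\<^sub>v u"
      using u by (auto simp: W_def)
    have "\<rho> x * \<rho> y = \<rho> y * \<rho> x"
      using matrix_representationD(3)[OF rep] x y by (metis m_comm)
    then have "\<rho> x *\<^sub>v (\<rho> y *\<^sub>v u) = \<rho> y *\<^sub>v (\<rho> x *\<^sub>v u)"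
      using car[OF x] car[OF y] uc by (metis assoc_mult_mat_vec)
    also have "\<dots> = k \<cdot>\<^sub>v (\<rho> y *\<^sub>v u)"
      unfolding ue using car[OF y] uc by (simp add: mult_mat_vec)
    finally show ?thesis
      using car[OF y] uc by (simp add: W_def)
  qed
  ultimately have "W = {0\<^sub>v d} \<or> W = carrier_vec d"
    using irr unfolding irreducible_representation_def by auto
  moreover have "v \<in> W"
    using v by (simp add: W_def)
  ultimately have "W = carrier_vec d"
    using v(2) by auto
  then show ?thesis
    unfolding W_def by blast
qed

text \<open>All operators are scalar, so every line is invariant. The line through the first unit
  vector would be a proper nonzero invariant subspace if \<open>d\<close> exceeded 1.\<close>

lemma irreducible_representation_dim_one:
  assumes G: "comm_group G" and irr: "irreducible_representation G d \<rho>"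
  shows "d = 1"
proof (rule ccontr)
  assume "d \<noteq> 1"
  moreover have "0 < d"
    using irr unfolding irreducible_representation_def by auto
  ultimately have d: "1 < d" by simp
  define W where "W = range (\<lambda>c::complex. c \<cdot>\<^sub>v unit_vec d 0)"
  have "subspace class_ring W (module_vec TYPE(complex) d)"
  proof (rule subspace_module_vecI)
    show "0\<^sub>v d \<in> W"
      unfolding W_def by (rule image_eqI[of _ _ 0]) auto
    show "u + v \<in> W" if "u \<in> W" "v \<in> W" for u v
      using that unfolding W_def by (auto simp flip: add_smult_distrib_vec)
    show "c \<cdot>\<^sub>v v \<in> W" if "v \<in> W" for c v
      using that unfolding W_def by (auto simp: smult_smult_assoc)
  qed (auto simp: W_def)
  moreover have "\<rho> x *\<^sub>v v \<in> W" if x: "x \<in> carrier G" and v: "v \<in> W" for x v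
  proof -
    obtain k where "\<And>v. v \<in> carrier_vec d \<Longrightarrow> \<rho> x *\<^sub>v v = k \<cdot>\<^sub>v v"
      using irreducible_representation_scalar[OF G irr x] by blast
    then show ?thesis
      using v unfolding W_def by (auto simp: smult_smult_assoc)
  qed
  ultimately have "W = {0\<^sub>v d} \<or> W = carrier_vec d"
    using irr unfolding irreducible_representation_def by auto
  then show False
  proof
    assume "W = {0\<^sub>v d}"
    moreover have "1 \<cdot>\<^sub>v unit_vec d 0 \<in> W"
      unfolding W_def by blast
    ultimately have "(1 \<cdot>\<^sub>v unit_vec d 0) $ 0 = (0\<^sub>v d :: complex vec) $ 0"
      by simp
    then show False
      using d by simp
  next
    \<comment> \<open>A second unit vector exists because \<open>1 < d\<close>; its coordinate 1 is
      nonzero, while that of every multiple of the first one vanishes.\<close>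
    assume "W = carrier_vec d"
    then have "unit_vec d 1 \<in> W"
      by simp
    then obtain c :: complex where "unit_vec d 1 = c \<cdot>\<^sub>v unit_vec d 0"
      unfolding W_def by blast
    then have "unit_vec d 1 $ 1 = (c \<cdot>\<^sub>v unit_vec d 0) $ 1"
      by simp
    then show False
      using d by simp
  qed
qed

text \<open>A nonzero vector has a nonzero single coordinate and can be rescaled to any other
  vector. This makes every one-dimensional representation irreducible.\<close>

lemma subspace_dim_one_cases:
  fixes W :: "complex vec set"
  assumes W: "subspace class_ring W (module_vec TYPE(complex) 1)"
  shows "W = {0\<^sub>v 1} \<or> W = carrier_vec 1"
proof -
  have sub: "W \<subseteq> carrier_vec 1" and zero: "0\<^sub>v 1 \<in> W"
    and smult: "\<And>c v. v \<in> W \<Longrightarrow> c \<cdot>\<^sub>v v \<in> W"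
    using W unfolding subspace_def submodule_def by (auto simp: module_vec_simps class_ring_simps)
  have "carrier_vec 1 \<subseteq> W" if "W \<noteq> {0\<^sub>v 1}"
  proof
    fix u :: "complex vec" assume u: "u \<in> carrier_vec 1"
    obtain v where v: "v \<in> W" "v \<noteq> 0\<^sub>v 1"
      using zero \<open>W \<noteq> {0\<^sub>v 1}\<close> by auto
    then have vc: "v \<in> carrier_vec 1"
      using sub by auto
    then have "v $ 0 \<noteq> 0"
      using v(2) by (auto intro: eq_vecI)
    then have "u = (u $ 0 / v $ 0) \<cdot>\<^sub>v v"
      using u vc by (intro eq_vecI) auto
    then show "u \<in> W"
      using smult v(1) by metis
  qed
  then show ?thesis
    using sub by auto
qed

section \<open>Irreducible characters of an abelian group are its linear characters\<close>

lemma linear_characters_eqI: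
  assumes "\<chi> \<in> extensional (carrier G)"
    and "\<And>x. x \<in> carrier G \<Longrightarrow> \<chi> x \<noteq> 0"
    and "\<And>x y. x \<in> carrier G \<Longrightarrow> y \<in> carrier G \<Longrightarrow> \<chi> (x \<otimes>\<^bsub>G\<^esub> y) = \<chi> x * \<chi> y"
  shows "\<chi> \<in> linear_characters G"
  using assms unfolding linear_characters_def hom_def complex_units_def by auto

lemma linear_charactersD:
  assumes "\<chi> \<in> linear_characters G"
  shows "\<chi> \<in> extensional (carrier G)"
    and "x \<in> carrier G \<Longrightarrow> \<chi> x \<noteq> 0"
    and "x \<in> carrier G \<Longrightarrow> y \<in> carrier G \<Longrightarrow> \<chi> (x \<otimes>\<^bsub>G\<^esub> y) = \<chi> x * \<chi> y"
  using assms unfolding linear_characters_def hom_def complex_units_def by auto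

lemma (in group) linear_character_one:
  assumes "\<chi> \<in> linear_characters G"
  shows "\<chi> \<one> = 1"
  using linear_charactersD(2)[OF assms, of \<one>] linear_charactersD(3)[OF assms, of \<one> \<one>] by simp

text \<open>In dimension one the trace is the only matrix entry. That entry is multiplicative, and
  it is nonzero because the matrix is invertible.\<close>

lemma irreducible_character_linear:
  assumes G: "comm_group G" and irr: "irreducible_representation G d \<rho>"
  shows "(\<lambda>x\<in>carrier G. \<Sum>i<d. \<rho> x $$ (i, i)) \<in> linear_characters G"
proof (rule linear_characters_eqI)
  interpret comm_group G by fact
  have d: "d = 1"
    using irreducible_representation_dim_one[OF G irr] .
  have rep: "matrix_representation G 1 \<rho>"
    using irr unfolding irreducible_representation_def d by auto
  note rho = matrix_representationD[OF rep]
  have prod: "(A * B) $$ (0, 0) = A $$ (0, 0) * B $$ (0, 0)"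
    if "A \<in> carrier_mat 1 1" "B \<in> carrier_mat 1 1" for A B :: "complex mat"
    using that by (simp add: scalar_prod_def)
  show "(\<lambda>x\<in>carrier G. \<Sum>i<d. \<rho> x $$ (i, i)) x \<noteq> 0" if "x \<in> carrier G" for x
  proof -
    obtain B where B: "B \<in> carrier_mat 1 1" "B * \<rho> x = 1\<^sub>m 1"
      using rho(2)[OF \<open>x \<in> carrier G\<close>] by blast
    have "B $$ (0, 0) * \<rho> x $$ (0, 0) = (B * \<rho> x) $$ (0, 0)"
      by (rule prod[OF B(1) rho(1)[OF \<open>x \<in> carrier G\<close>], symmetric])
    also have "\<dots> = 1"
      unfolding B(2) by simp
    finally have "B $$ (0, 0) * \<rho> x $$ (0, 0) = 1" .
    then show ?thesis
      using that by (auto simp: d)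
  qed
  show "(\<lambda>x\<in>carrier G. \<Sum>i<d. \<rho> x $$ (i, i)) (x \<otimes>\<^bsub>G\<^esub> y)
      = (\<lambda>x\<in>carrier G. \<Sum>i<d. \<rho> x $$ (i, i)) x * (\<lambda>x\<in>carrier G. \<Sum>i<d. \<rho> x $$ (i, i)) y"
    if "x \<in> carrier G" "y \<in> carrier G" for x y
    using that rho(3)[OF that] prod[OF rho(1)[OF that(1)] rho(1)[OF that(2)]] by (simp add: d)
qed auto

lemma linear_character_irreducible:
  assumes G: "group G" and \<chi>: "\<chi> \<in> linear_characters G"
  shows "irreducible_representation G 1 (\<lambda>x. mat 1 1 (\<lambda>_. \<chi> x))"
proof -
  interpret group G by fact
  have mult: "mat 1 1 (\<lambda>_. a) * mat 1 1 (\<lambda>_. b) = mat 1 1 (\<lambda>_. a * b)" for a b :: complex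
    by (intro eq_matI) (auto simp: scalar_prod_def)
  have one: "mat 1 1 (\<lambda>_. 1) = (1\<^sub>m 1 :: complex mat)"
    by (intro eq_matI) auto
  have "\<exists>B\<in>carrier_mat 1 1. B * mat 1 1 (\<lambda>_. \<chi> x) = 1\<^sub>m 1 \<and> mat 1 1 (\<lambda>_. \<chi> x) * B = 1\<^sub>m 1"
    if "x \<in> carrier G" for x
    using linear_charactersD(2)[OF \<chi> that]
    by (intro bexI[of _ "mat 1 1 (\<lambda>_. inverse (\<chi> x))"]) (auto simp: mult one simp del: One_nat_def)
  then have "matrix_representation G 1 (\<lambda>x. mat 1 1 (\<lambda>_. \<chi> x))"
    unfolding matrix_representation_def hom_def units_of_def Units_def
    using linear_charactersD(3)[OF \<chi>] by (auto simp: ring_mat_simps mult simp del: One_nat_def)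
  then show ?thesis
    unfolding irreducible_representation_def using subspace_dim_one_cases by auto
qed

lemma irreducible_characters_comm_group:
  assumes G: "comm_group G"
  shows "irreducible_characters G = linear_characters G"
proof
  show "irreducible_characters G \<subseteq> linear_characters G"
    unfolding irreducible_characters_def using irreducible_character_linear[OF G] by auto
  show "linear_characters G \<subseteq> irreducible_characters G"
  proof
    fix \<chi> assume \<chi>: "\<chi> \<in> linear_characters G"
    \<comment> \<open>Equality as functions, not only on the group: both sides are
      \<open>undefined\<close> outside the carrier.\<close>
    have "\<chi> = (\<lambda>x\<in>carrier G. \<Sum>i<1. mat 1 1 (\<lambda>_. \<chi> x) $$ (i, i))"
      using linear_charactersD(1)[OF \<chi>] by (auto intro: extensionalityI)
    moreover have "irreducible_representation G 1 (\<lambda>x. mat 1 1 (\<lambda>_. \<chi> x))"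
      using linear_character_irreducible[OF comm_group.axioms(2)[OF G] \<chi>] .
    ultimately show "\<chi> \<in> irreducible_characters G"
      unfolding irreducible_characters_def
      by (intro CollectI exI[of _ 1] exI[of _ "\<lambda>x. mat 1 1 (\<lambda>_. \<chi> x)"] conjI)
  qed
qed

text \<open>Lets the columns of the character table, which are labelled by class representatives, be
  labelled by the group elements themselves.\<close>

lemma (in comm_group) conjugacy_class_eq:
  assumes "x \<in> carrier G"
  shows "conjugacy_class G x = {x}"
proof -
  have "g \<otimes> x \<otimes> inv g = x" if "g \<in> carrier G" for g
    using assms that by (metis inv_closed m_assoc m_comm r_inv r_one)
  then show ?thesis
    unfolding conjugacy_class_def by auto (metis one_closed)
qed

section \<open>Orthogonality of linear characters\<close>

text \<open>Translation by \<open>g\<close> permutes the group and multiplies the sum by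
  \<open>\<chi> g\<close>, which differs from 1.\<close>

lemma (in group) sum_linear_character_eq_0:
  assumes \<chi>: "\<chi> \<in> linear_characters G"
    and g: "g \<in> carrier G" "\<chi> g \<noteq> 1"
  shows "(\<Sum>x\<in>carrier G. \<chi> x) = 0"
proof -
  have bij: "bij_betw (\<lambda>x. g \<otimes> x) (carrier G) (carrier G)"
    by (rule bij_betwI[where g = "\<lambda>x. inv g \<otimes> x"]) (use g in \<open>auto simp flip: m_assoc\<close>)
  have "(\<Sum>x\<in>carrier G. \<chi> x) = (\<Sum>x\<in>carrier G. \<chi> (g \<otimes> x))"
    using sum.reindex_bij_betw[OF bij, of \<chi>] by simp
  also have "\<dots> = \<chi> g * (\<Sum>x\<in>carrier G. \<chi> x)"
    by (simp add: linear_charactersD(3)[OF \<chi> g(1)] sum_distrib_left)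
  finally show ?thesis
    using g(2) by simp
qed

text \<open>By Lagrange the value is a root of unity, so its norm is a nonnegative real with a
  positive power equal to 1. Consequently conjugation inverts character values.\<close>

lemma (in group) norm_linear_character:
  assumes fin: "finite (carrier G)" and \<chi>: "\<chi> \<in> linear_characters G" and x: "x \<in> carrier G"
  shows "norm (\<chi> x) = 1"
proof -
  have pow: "\<chi> (x [^] k) = \<chi> x ^ k" for k :: nat
    by (induction k) (use x linear_character_one[OF \<chi>] in \<open>auto simp: linear_charactersD(3)[OF \<chi>]\<close>)
  have "\<chi> x ^ Coset.order G = 1"
    using pow[of "Coset.order G"] pow_order_eq_1[OF x] linear_character_one[OF \<chi>] by simp
  then have "norm (\<chi> x) ^ Coset.order G = 1"
    by (simp flip: norm_power)
  moreover have "Coset.order G > 0"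
    using fin by (simp add: order_gt_0_iff_finite)
  ultimately show ?thesis
    using power_eq_imp_eq_base[of "norm (\<chi> x)" "Coset.order G" 1] by simp
qed

text \<open>The product of \<open>\<chi>\<close> with the conjugate of \<open>\<psi>\<close> is
  again a linear character; it is trivial only when the two agree, so otherwise its sum
  vanishes.\<close>

lemma (in group) linear_characters_orthogonal:
  assumes fin: "finite (carrier G)" and \<chi>: "\<chi> \<in> linear_characters G"
    and \<psi>: "\<psi> \<in> linear_characters G"
  shows "(\<Sum>x\<in>carrier G. \<chi> x * cnj (\<psi> x)) = (if \<chi> = \<psi> then of_nat (Coset.order G) else 0)"
proof (cases "\<chi> = \<psi>")
  case True
  have "\<psi> x * cnj (\<psi> x) = 1" if "x \<in> carrier G" for x
    using complex_norm_square[of "\<psi> x"] norm_linear_character[OF fin \<psi> that] by simp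
  then show ?thesis
    using True by (simp add: Coset.order_def)
next
  case False
  define \<theta> where "\<theta> = (\<lambda>x\<in>carrier G. \<chi> x * cnj (\<psi> x))"
  have \<theta>: "\<theta> \<in> linear_characters G"
    by (rule linear_characters_eqI)
      (auto simp: \<theta>_def linear_charactersD(2,3)[OF \<chi>] linear_charactersD(2,3)[OF \<psi>])
  obtain g where g: "\<chi> g \<noteq> \<psi> g"
    using False by blast
  \<comment> \<open>Extensional functions agree off the carrier, so a point of disagreement lies in
    the group.\<close>
  have gc: "g \<in> carrier G"
    using g linear_charactersD(1)[OF \<chi>] linear_charactersD(1)[OF \<psi>]
    by (metis extensional_arb)
  have "cnj (\<psi> g) * \<psi> g = 1"
    using complex_norm_square[of "\<psi> g"] norm_linear_character[OF fin \<psi> gc] by (simp add: mult.commute)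
  have "\<theta> g \<noteq> 1"
  proof
    assume "\<theta> g = 1"
    then have "\<chi> g * (cnj (\<psi> g) * \<psi> g) = \<psi> g"
      using gc by (simp add: \<theta>_def flip: mult.assoc)
    then show False
      using g \<open>cnj (\<psi> g) * \<psi> g = 1\<close> by simp
  qed
  have "(\<Sum>x\<in>carrier G. \<chi> x * cnj (\<psi> x)) = (\<Sum>x\<in>carrier G. \<theta> x)"
    by (simp add: \<theta>_def)
  then show ?thesis
    using sum_linear_character_eq_0[OF \<theta> gc \<open>\<theta> g \<noteq> 1\<close>] False by simp
qed

section \<open>Mixed radix digits\<close>

text \<open>The first cyclic factor owns the least significant digit, since each later factor forms
  the outer blocks of both the listing and the matrix.\<close>

definition digit :: "(nat \<Rightarrow> nat) \<Rightarrow> nat \<Rightarrow> nat \<Rightarrow> nat" where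
  "digit n i a = (a div (\<Prod>k\<in>{1..<i}. n k)) mod n i"

lemma prod_atLeast1_Suc: "(\<Prod>i\<in>{1..Suc m}. f i) = f (Suc m) * (\<Prod>i\<in>{1..m}. f i)"
  for f :: "nat \<Rightarrow> 'k :: comm_monoid_mult"
  by (simp add: mult.commute)

lemma digit_less: "0 < n i \<Longrightarrow> digit n i a < n i"
  by (simp add: digit_def)

lemma digit_0 [simp]: "digit n i 0 = 0"
  by (simp add: digit_def)

text \<open>Below the full product the quotient is already less than \<open>n (Suc m)\<close>, so
  the reduction modulo \<open>n (Suc m)\<close> does nothing. The top digit is thus the block number
  of \<open>a\<close>.\<close>

lemma digit_top:
  assumes "a < (\<Prod>i\<in>{1..Suc m}. n i)"
  shows "digit n (Suc m) a = a div (\<Prod>i\<in>{1..m}. n i)"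
proof -
  have "a div (\<Prod>i\<in>{1..m}. n i) < n (Suc m)"
    using assms unfolding prod_atLeast1_Suc by (rule less_mult_imp_div_less)
  then show ?thesis
    by (simp add: digit_def atLeastLessThanSuc_atLeastAtMost)
qed

text \<open>The modulus is a multiple of the place value of digit \<open>i\<close> times
  \<open>n i\<close>, so the reduction does not affect this digit. Hence the offset of
  \<open>a\<close> inside its block keeps all lower digits.\<close>

lemma digit_mod:
  assumes "i \<in> {1..m}"
  shows "digit n i (a mod (\<Prod>i\<in>{1..m}. n i)) = digit n i a"
proof -
  let ?x = "\<Prod>k\<in>{1..<i}. n k" and ?z = "\<Prod>k\<in>{Suc i..m}. n k"
  have "{1..m} = {1..<i} \<union> ({i} \<union> {Suc i..m})"
    using assms by auto
  then have "(\<Prod>i\<in>{1..m}. n i) = ?x * (\<Prod>k\<in>{i} \<union> {Suc i..m}. n k)"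
    by (simp only:) (subst prod.union_disjoint, auto)
  then have eq: "(\<Prod>i\<in>{1..m}. n i) = ?x * (n i * ?z)"
    by simp
  have div: "a mod (x * y) div x = a div x mod y" for x y :: nat
    by (cases "x = 0") (simp_all add: mod_mult2_eq)
  then show ?thesis
    unfolding digit_def eq div by (simp add: mod_mod_cancel)
qed

text \<open>By induction the lower digits determine the remainder modulo the product of the first
  \<open>m\<close> radices, and the top digit is the quotient.\<close>

lemma digits_inj:
  assumes "a < (\<Prod>i\<in>{1..m}. n i)" "b < (\<Prod>i\<in>{1..m}. n i)"
    and "\<And>i. i \<in> {1..m} \<Longrightarrow> digit n i a = digit n i b"
  shows "a = b"
  using assms
proof (induction m arbitrary: a b)
  case (Suc m)
  let ?N = "\<Prod>i\<in>{1..m}. n i"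
  \<comment> \<open>An index below the full product exists, so no radix can be zero.\<close>
  have "0 < ?N"
    using Suc.prems(1) unfolding prod_atLeast1_Suc by (metis mult_0_right not_gr_zero not_less_zero)
  have "a mod ?N = b mod ?N"
  proof (rule Suc.IH)
    show "digit n i (a mod ?N) = digit n i (b mod ?N)" if "i \<in> {1..m}" for i
      using Suc.prems(3)[of i] that by (simp only: digit_mod[OF that]) simp
  qed (use \<open>0 < ?N\<close> in auto)
  moreover have "a div ?N = b div ?N"
    using Suc.prems(3)[of "Suc m"] digit_top[OF Suc.prems(1)] digit_top[OF Suc.prems(2)] by simp
  ultimately show ?case
    by (metis div_mult_mod_eq)
qed simp

section \<open>Explicit form of the listing and of the matrix\<close>

text \<open>The induction runs over the initial blocks \<open>[0..<m]\<close> with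
  \<open>m \<le> k\<close>, keeping \<open>k\<close> fixed because the length hypothesis covers only
  the first \<open>k\<close> blocks.\<close>

lemma
  assumes "\<And>j. j < k \<Longrightarrow> length (f j) = l"
  shows length_concat_map_upt: "length (concat (map f [0..<k])) = k * l"
    and nth_concat_map_upt: "a < k * l \<Longrightarrow> concat (map f [0..<k]) ! a = f (a div l) ! (a mod l)"
proof -
  have len: "length (concat (map f [0..<m])) = m * l" if "m \<le> k" for m
    using that assms by (induction m) auto
  then show "length (concat (map f [0..<k])) = k * l"
    by simp
  have "concat (map f [0..<m]) ! a = f (a div l) ! (a mod l)" if "m \<le> k" "a < m * l" for m
    using that
  proof (induction m)
    case (Suc m)
    show ?case
    proof (cases "a < m * l")
      case True
      then show ?thesis
        using Suc len[of m] by (simp add: nth_append)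
    next
      case False
      then have "a - m * l < l" "a = m * l + (a - m * l)"
        using Suc.prems by auto
      then have "a div l = m" "a mod l = a - m * l"
        by (metis add.right_neutral div_less div_mult_self3 gr_implies_not0 less_nat_zero_code,
            metis mod_less mod_mult_self3)
      then show ?thesis
        using Suc.prems False len[of m] by (simp add: nth_append)
    qed
  qed simp
  then show "a < k * l \<Longrightarrow> concat (map f [0..<k]) ! a = f (a div l) ! (a mod l)"
    by simp
qed

text \<open>Merges the two recursive equations into one: the listing of a single factor is also the
  block step applied to \<open>[\<one>]\<close>, since multiplying by the unit changes
  nothing.\<close>

lemma (in monoid) cyclic_listing_Suc:
  assumes "h (Suc m) \<in> carrier G"
  shows "cyclic_listing G n h (Suc m) =
    concat (map (\<lambda>j. map (\<lambda>x. h (Suc m) [^] j \<otimes> x) (cyclic_listing G n h m)) [0..<n (Suc m)])"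
proof (cases m)
  case 0
  then show ?thesis
    using assms by (auto simp: concat_map_singleton intro!: map_cong)
qed (auto simp: numeral_2_eq_2)

text \<open>Induction on the number of factors: the block number of position \<open>a\<close> is its
  top digit and gives the exponent of the new generator, while the offset in the block carries the
  other exponents.\<close>

lemma (in comm_group)
  assumes "\<And>i. i \<in> {1..m} \<Longrightarrow> h i \<in> carrier G"
  shows length_cyclic_listing: "length (cyclic_listing G n h m) = (\<Prod>i\<in>{1..m}. n i)"
    and nth_cyclic_listing: "a < (\<Prod>i\<in>{1..m}. n i) \<Longrightarrow>
      cyclic_listing G n h m ! a = finprod G (\<lambda>i. h i [^] digit n i a) {1..m}"
proof -
  have "length (cyclic_listing G n h m) = (\<Prod>i\<in>{1..m}. n i) \<and>
    (\<forall>a<(\<Prod>i\<in>{1..m}. n i).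
      cyclic_listing G n h m ! a = finprod G (\<lambda>i. h i [^] digit n i a) {1..m})"
    using assms
  proof (induction m)
    case 0
    then show ?case by simp
  next
    case (Suc m)
    let ?N = "\<Prod>i\<in>{1..m}. n i"
    have h: "h i \<in> carrier G" if "i \<in> {1..Suc m}" for i
      using Suc.prems that by blast
    have IH: "length (cyclic_listing G n h m) = ?N"
      "\<And>a. a < ?N \<Longrightarrow> cyclic_listing G n h m ! a = finprod G (\<lambda>i. h i [^] digit n i a) {1..m}"
      using Suc by auto
    note step = cyclic_listing_Suc[where h = h and m = m and n = n, OF h]
    have len: "length (map (\<lambda>x. h (Suc m) [^] j \<otimes> x) (cyclic_listing G n h m)) = ?N" for j :: nat
      using IH(1) by simp
    have nth: "cyclic_listing G n h (Suc m) ! a = finprod G (\<lambda>i. h i [^] digit n i a) {1..Suc m}"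
      if a: "a < (\<Prod>i\<in>{1..Suc m}. n i)" for a
    proof -
      have a': "a < n (Suc m) * ?N"
        using a by (simp only: prod_atLeast1_Suc)
      then have N: "a mod ?N < ?N"
        by (metis mod_less_divisor mult_0_right not_gr_zero not_less_zero)
      have "cyclic_listing G n h (Suc m) ! a
          = map (\<lambda>x. h (Suc m) [^] (a div ?N) \<otimes> x) (cyclic_listing G n h m) ! (a mod ?N)"
        using nth_concat_map_upt[where f = "\<lambda>j. map (\<lambda>x. h (Suc m) [^] j \<otimes> x) (cyclic_listing G n h m)",
            OF len a'] step by simp
      also have "\<dots> = h (Suc m) [^] (a div ?N)
          \<otimes> finprod G (\<lambda>i. h i [^] digit n i (a mod ?N)) {1..m}"
        using IH N by simp
      also have "finprod G (\<lambda>i. h i [^] digit n i (a mod ?N)) {1..m}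
          = finprod G (\<lambda>i. h i [^] digit n i a) {1..m}"
        using h by (intro finprod_cong') (auto simp only: digit_mod intro!: nat_pow_closed, auto)
      also have "a div ?N = digit n (Suc m) a"
        using digit_top[OF a] by simp
      also have "h (Suc m) [^] digit n (Suc m) a \<otimes> finprod G (\<lambda>i. h i [^] digit n i a) {1..m}
          = finprod G (\<lambda>i. h i [^] digit n i a) (insert (Suc m) {1..m})"
        using h by (intro finprod_insert[symmetric]) auto
      also have "insert (Suc m) {1..m} = {1..Suc m}"
        by auto
      finally show ?thesis .
    qed
    have "length (cyclic_listing G n h (Suc m)) = n (Suc m) * ?N"
      using step length_concat_map_upt[where f = "\<lambda>j. map (\<lambda>x. h (Suc m) [^] j \<otimes> x)
        (cyclic_listing G n h m)", OF len] by simp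
    then show ?case
      using nth by (simp only: prod_atLeast1_Suc) blast
  qed
  then show "length (cyclic_listing G n h m) = (\<Prod>i\<in>{1..m}. n i)"
    and "a < (\<Prod>i\<in>{1..m}. n i) \<Longrightarrow>
      cyclic_listing G n h m ! a = finprod G (\<lambda>i. h i [^] digit n i a) {1..m}"
    by blast+
qed

text \<open>The Fourier matrix of the first factor is the block construction over the 1 by 1
  identity, so a single recursion covers all cases.\<close>

lemma iterated_fourier_mat_Suc:
  "iterated_fourier_mat n w (Suc m) =
    block_fourier_mat (n (Suc m)) (w (Suc m)) (iterated_fourier_mat n w m)"
proof (cases m)
  case 0
  then show ?thesis
    by (auto simp: fourier_mat_def block_fourier_mat_def intro!: eq_matI)
qed (auto simp: numeral_2_eq_2)

text \<open>The block coordinates of an entry are the top digits of \<open>a\<close> and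
  \<open>b\<close> and contribute the new power of \<open>w (Suc m)\<close>; the position inside the
  block contributes the powers for the lower digits.\<close>

lemma
  shows iterated_fourier_mat_carrier: "iterated_fourier_mat n w m \<in>
      carrier_mat (\<Prod>i\<in>{1..m}. n i) (\<Prod>i\<in>{1..m}. n i)"
    and iterated_fourier_mat_index:
      "a < (\<Prod>i\<in>{1..m}. n i) \<Longrightarrow> b < (\<Prod>i\<in>{1..m}. n i) \<Longrightarrow>
        iterated_fourier_mat n w m $$ (a, b) = (\<Prod>i\<in>{1..m}. w i ^ (digit n i a * digit n i b))"
proof -
  have "iterated_fourier_mat n w m \<in> carrier_mat (\<Prod>i\<in>{1..m}. n i) (\<Prod>i\<in>{1..m}. n i) \<and>
    (\<forall>a<(\<Prod>i\<in>{1..m}. n i). \<forall>b<(\<Prod>i\<in>{1..m}. n i).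
      iterated_fourier_mat n w m $$ (a, b) = (\<Prod>i\<in>{1..m}. w i ^ (digit n i a * digit n i b)))"
  proof (induction m)
    case 0
    then show ?case by auto
  next
    case (Suc m)
    let ?N = "\<Prod>i\<in>{1..m}. n i" and ?P = "iterated_fourier_mat n w m"
    have dim: "dim_row ?P = ?N" "dim_col ?P = ?N"
      using Suc by auto
    have idx: "iterated_fourier_mat n w (Suc m) $$ (a, b)
        = (\<Prod>i\<in>{1..Suc m}. w i ^ (digit n i a * digit n i b))"
      if a: "a < (\<Prod>i\<in>{1..Suc m}. n i)" and b: "b < (\<Prod>i\<in>{1..Suc m}. n i)" for a b
    proof -
      have ab: "a < n (Suc m) * ?N" "b < n (Suc m) * ?N"
        using a b by (simp_all only: prod_atLeast1_Suc)
      then have N: "a mod ?N < ?N" "b mod ?N < ?N"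
        by (metis mod_less_divisor mult_0_right not_gr_zero not_less_zero)+
      have "iterated_fourier_mat n w (Suc m) $$ (a, b)
          = w (Suc m) ^ ((a div ?N) * (b div ?N)) * ?P $$ (a mod ?N, b mod ?N)"
        unfolding iterated_fourier_mat_Suc block_fourier_mat_def dim using ab by simp
      also have "?P $$ (a mod ?N, b mod ?N)
          = (\<Prod>i\<in>{1..m}. w i ^ (digit n i (a mod ?N) * digit n i (b mod ?N)))"
        using Suc.IH N by blast
      also have "\<dots> = (\<Prod>i\<in>{1..m}. w i ^ (digit n i a * digit n i b))"
        by (intro prod.cong refl) (simp only: digit_mod)
      finally show ?thesis
        by (simp only: prod_atLeast1_Suc digit_top[OF a] digit_top[OF b])
    qed
    have "iterated_fourier_mat n w (Suc m) \<in> carrier_mat (n (Suc m) * ?N) (n (Suc m) * ?N)"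
      unfolding iterated_fourier_mat_Suc block_fourier_mat_def dim by simp
    then show ?case
      using idx by (simp only: prod_atLeast1_Suc) blast
  qed
  then show "iterated_fourier_mat n w m \<in> carrier_mat (\<Prod>i\<in>{1..m}. n i) (\<Prod>i\<in>{1..m}. n i)"
    and "a < (\<Prod>i\<in>{1..m}. n i) \<Longrightarrow> b < (\<Prod>i\<in>{1..m}. n i) \<Longrightarrow>
        iterated_fourier_mat n w m $$ (a, b) = (\<Prod>i\<in>{1..m}. w i ^ (digit n i a * digit n i b))"
    by blast+
qed

section \<open>Primitive roots of unity\<close>

text \<open>The witness is \<open>exp (2 * pi * \<i> / k)\<close>, whose powers below
  \<open>k\<close> are distinct; comparing with the exponent 0 gives primitivity.\<close>

lemma primitive_root_of_unity_exists:
  assumes "0 < k"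
  shows "\<exists>z. primitive_root_of_unity k z"
proof -
  let ?z = "cis (2 * pi / real k)"
  have pow: "?z ^ m = cis (2 * pi * real m / real k)" for m
    by (simp add: DeMoivre mult_ac)
  have "?z ^ m \<noteq> 1" if "0 < m" "m < k" for m
  proof
    assume "?z ^ m = 1"
    then have "cis (2 * pi * real m / real k) = cis (2 * pi * real 0 / real k)"
      by (simp add: pow)
    then have "m = 0"
      using bij_betw_roots_unity[OF assms] that unfolding bij_betw_def inj_on_def by auto
    with that show False by simp
  qed
  moreover have "?z ^ k = 1"
    using assms by (simp add: pow)
  ultimately show ?thesis
    using assms unfolding primitive_root_of_unity_def by blast
qed

lemma primitive_root_pow_mod:
  assumes "primitive_root_of_unity k z"
  shows "z ^ (m mod k) = z ^ m"
proof -
  have "z ^ m = z ^ (k * (m div k) + m mod k)"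
    by simp
  also have "\<dots> = (z ^ k) ^ (m div k) * z ^ (m mod k)"
    by (simp only: power_add power_mult)
  finally show ?thesis
    using assms by (simp add: primitive_root_of_unity_def)
qed

lemma primitive_root_inj_on:
  assumes z: "primitive_root_of_unity k z"
  shows "inj_on (\<lambda>m. z ^ m) {..<k}"
proof (rule linorder_inj_onI)
  fix a b assume "a < b" "a \<in> {..<k}" "b \<in> {..<k}"
  moreover have "z \<noteq> 0"
    using z by (auto simp: primitive_root_of_unity_def power_0_left)
  moreover have "z ^ b = z ^ a * z ^ (b - a)"
    using \<open>a < b\<close> by (simp flip: power_add)
  ultimately show "z ^ a \<noteq> z ^ b"
    using z unfolding primitive_root_of_unity_def by auto
qed auto

text \<open>A counting argument: the \<open>k\<close> powers of \<open>z\<close> are distinct roots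
  of unity, and there are exactly \<open>k\<close> such roots.\<close>

lemma root_of_unity_eq_primitive_power:
  assumes z: "primitive_root_of_unity k z" and u: "u ^ k = 1"
  shows "\<exists>m<k. u = z ^ m"
proof -
  have "0 < k"
    using z by (simp add: primitive_root_of_unity_def)
  have sub: "(\<lambda>m. z ^ m) ` {..<k} \<subseteq> {u. u ^ k = 1}"
  proof clarify
    fix m
    have "(z ^ m) ^ k = (z ^ k) ^ m"
      by (simp only: mult.commute flip: power_mult)
    then show "(z ^ m) ^ k = 1"
      using z by (simp add: primitive_root_of_unity_def)
  qed
  have "card ((\<lambda>m. z ^ m) ` {..<k}) = card {u::complex. u ^ k = 1}"
    using card_image[OF primitive_root_inj_on[OF z]] card_roots_unity_eq[OF \<open>0 < k\<close>] by simp
  then have "(\<lambda>m. z ^ m) ` {..<k} = {u. u ^ k = 1}"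
    using sub finite_roots_unity[of k] \<open>0 < k\<close> by (intro card_subset_eq) auto
  then show ?thesis
    using u by blast
qed

section \<open>Characters of a product of cyclic groups\<close>

lemma (in comm_group) linear_character_finprod:
  assumes \<chi>: "\<chi> \<in> linear_characters G" and "f \<in> I \<rightarrow> carrier G"
  shows "\<chi> (finprod G f I) = (\<Prod>i\<in>I. \<chi> (f i))"
  using assms(2)
  by (induction I rule: infinite_finite_induct)
    (auto simp: linear_character_one[OF \<chi>] linear_charactersD(3)[OF \<chi>])

lemma (in group) linear_character_pow:
  assumes \<chi>: "\<chi> \<in> linear_characters G" and x: "x \<in> carrier G"
  shows "\<chi> (x [^] (k :: nat)) = \<chi> x ^ k"
  by (induction k)
    (use x in \<open>auto simp: linear_character_one[OF \<chi>] linear_charactersD(3)[OF \<chi>]\<close>)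

section \<open>Exponent coordinates on the group and its listing\<close>

locale cyclic_product = comm_group Q for Q (structure) +
  fixes t :: nat and n :: "nat \<Rightarrow> nat" and h :: "nat \<Rightarrow> 'a"
  assumes fin: "finite (carrier Q)"
    and decomp: "cyclic_decomposition Q t n h"
begin

abbreviation N :: nat where "N \<equiv> \<Prod>i\<in>{1..t}. n i"

definition exp_prod :: "(nat \<Rightarrow> nat) \<Rightarrow> 'a" where
  "exp_prod e = finprod Q (\<lambda>i. h i [^] e i) {1..t}"

lemma h_closed: "i \<in> {1..t} \<Longrightarrow> h i \<in> carrier Q"
  using decomp by (simp add: cyclic_decomposition_def)

lemma ord_h: "i \<in> {1..t} \<Longrightarrow> ord (h i) = n i"
  using decomp cyclic_order_is_ord[OF h_closed] by (simp add: cyclic_decomposition_def)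

lemma n_pos: "i \<in> {1..t} \<Longrightarrow> 0 < n i"
  using ord_h[of i] ord_ge_1[OF fin h_closed, of i] by simp

lemma h_pow_eq_iff: "i \<in> {1..t} \<Longrightarrow> h i [^] (a :: nat) = h i [^] (b :: nat) \<longleftrightarrow> a mod n i = b mod n i"
proof -
  assume i: "i \<in> {1..t}"
  \<comment> \<open>Over the integers the difference of the exponents may have either sign.\<close>
  have "h i [^] a = h i [^] b \<longleftrightarrow> int (n i) dvd int b - int a"
    using int_pow_eq[OF h_closed[OF i], of "int a" "int b"] ord_h[OF i] by (simp add: int_pow_int)
  also have "\<dots> \<longleftrightarrow> int b mod int (n i) = int a mod int (n i)"
    by (rule mod_eq_dvd_iff[symmetric])
  also have "\<dots> \<longleftrightarrow> a mod n i = b mod n i"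
    by (auto simp flip: of_nat_mod)
  finally show ?thesis .
qed

lemma exp_prod_closed: "exp_prod e \<in> carrier Q"
  unfolding exp_prod_def using h_closed by (intro finprod_closed) auto

lemma exp_prod_mult: "exp_prod e \<otimes> exp_prod f = exp_prod (\<lambda>i. e i + f i)"
proof -
  have "exp_prod (\<lambda>i. e i + f i) = finprod Q (\<lambda>i. h i [^] e i \<otimes> h i [^] f i) {1..t}"
    unfolding exp_prod_def using h_closed by (intro finprod_cong') (auto simp: nat_pow_mult)
  also have "\<dots> = exp_prod e \<otimes> exp_prod f"
    unfolding exp_prod_def using h_closed by (intro finprod_multf) auto
  finally show ?thesis ..
qed

text \<open>Directness of the product separates the factors, and within a factor the exponent
  matters modulo the order of \<open>h i\<close>.\<close>

lemma exp_prod_eq_iff: "exp_prod e = exp_prod f \<longleftrightarrow> (\<forall>i\<in>{1..t}. e i mod n i = f i mod n i)"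
proof
  \<comment> \<open>Elements of the product group are extensional tuples, so the powers must be
    restricted to the index set before injectivity applies.\<close>
  have mem: "(\<lambda>i\<in>{1..t}. h i [^] e i)
      \<in> carrier (product_group {1..t} (\<lambda>i. subgroup_generated Q {h i}))" for e :: "nat \<Rightarrow> nat"
  proof -
    have "h i [^] e i \<in> carrier (subgroup_generated Q {h i})" if "i \<in> {1..t}" for i
      unfolding carrier_subgroup_generated_by_singleton[OF h_closed[OF that]]
      by (metis int_pow_int rangeI)
    then show ?thesis by auto
  qed
  have restr: "finprod Q (\<lambda>i\<in>{1..t}. h i [^] e i) {1..t} = exp_prod e" for e :: "nat \<Rightarrow> nat"
    unfolding exp_prod_def using h_closed by (intro finprod_cong') auto
  have inj: "inj_on (\<lambda>x. finprod Q x {1..t})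
      (carrier (product_group {1..t} (\<lambda>i. subgroup_generated Q {h i})))"
    using decomp by (auto simp: cyclic_decomposition_def iso_def bij_betw_def)
  assume "exp_prod e = exp_prod f"
  then have "(\<lambda>i\<in>{1..t}. h i [^] e i) = (\<lambda>i\<in>{1..t}. h i [^] f i)"
    by (intro inj_onD[OF inj _ mem mem]) (simp only: restr)
  then have "h i [^] e i = h i [^] f i" if "i \<in> {1..t}" for i
    using that by (auto dest!: fun_cong[of _ _ i])
  then show "\<forall>i\<in>{1..t}. e i mod n i = f i mod n i"
    using h_pow_eq_iff by blast
next
  assume "\<forall>i\<in>{1..t}. e i mod n i = f i mod n i"
  then show "exp_prod e = exp_prod f"
    unfolding exp_prod_def using h_pow_eq_iff h_closed by (intro finprod_cong') auto
qed

lemma order_eq: "Coset.order Q = N"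
proof -
  have "card (carrier (product_group {1..t} (\<lambda>i. subgroup_generated Q {h i}))) = card (carrier Q)"
    using decomp by (auto simp: cyclic_decomposition_def iso_def intro: bij_betw_same_card)
  then have "Coset.order Q = (\<Prod>i\<in>{1..t}. Coset.order (subgroup_generated Q {h i}))"
    by (simp add: card_PiE Coset.order_def)
  also have "\<dots> = N"
    using decomp by (intro prod.cong) (auto simp: cyclic_decomposition_def)
  finally show ?thesis .
qed

abbreviation xs :: "'a list" where "xs \<equiv> cyclic_listing Q n h t"

lemma length_xs: "length xs = N"
  by (rule length_cyclic_listing) (rule h_closed)

lemma nth_xs: "a < N \<Longrightarrow> xs ! a = exp_prod (\<lambda>i. digit n i a)"
  unfolding exp_prod_def by (rule nth_cyclic_listing) (rule h_closed)

lemma distinct_xs: "distinct xs"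
proof -
  have "a = b" if ab: "a < N" "b < N" and eq: "xs ! a = xs ! b" for a b
  proof (rule digits_inj[OF ab])
    fix i assume i: "i \<in> {1..t}"
    then have "digit n i a mod n i = digit n i b mod n i"
      using eq unfolding nth_xs[OF ab(1)] nth_xs[OF ab(2)] exp_prod_eq_iff by blast
    then show "digit n i a = digit n i b"
      by (simp add: digit_less n_pos[OF i])
  qed
  then show ?thesis
    unfolding distinct_conv_nth length_xs by blast
qed

text \<open>Counting: the listing has \<open>N\<close> distinct members of a group of order
  \<open>N\<close>.\<close>

lemma set_xs: "set xs = carrier Q"
proof (rule card_subset_eq[OF fin])
  show "set xs \<subseteq> carrier Q"
    using exp_prod_closed by (auto simp: in_set_conv_nth length_xs nth_xs)
  show "card (set xs) = card (carrier Q)"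
    using distinct_card[OF distinct_xs] length_xs order_eq by (simp add: Coset.order_def)
qed

lemma bij_betw_xs: "bij_betw ((!) xs) {..<N} (carrier Q)"
  using bij_betw_nth[OF distinct_xs, of "{..<N}"] by (simp add: length_xs set_xs)

lemma exp_prod_surj:
  assumes "x \<in> carrier Q"
  obtains a where "a < N" "x = exp_prod (\<lambda>i. digit n i a)"
  using assms bij_betw_xs nth_xs unfolding bij_betw_def by (metis imageE lessThan_iff)

end

section \<open>Characters determined by their values on the generators\<close>

locale cyclic_product_roots = cyclic_product +
  fixes w :: "nat \<Rightarrow> complex"
  assumes prim: "\<And>i. i \<in> {1..t} \<Longrightarrow> primitive_root_of_unity (n i) (w i)"
begin

text \<open>The character taking the value \<open>w i ^ f i\<close> at the generator \<open>h i\<close>.\<close>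

definition chi :: "(nat \<Rightarrow> nat) \<Rightarrow> 'a \<Rightarrow> complex" where
  "chi f = (\<lambda>x\<in>carrier Q. \<Prod>i\<in>{1..t}. w i ^ ((SOME e. exp_prod e = x) i * f i))"

text \<open>Independence of the choice made in \<open>chi\<close>: the chosen exponents agree with
  \<open>e\<close> modulo \<open>n i\<close>, and \<open>w i\<close> has order
  \<open>n i\<close>.\<close>

lemma chi_exp_prod: "chi f (exp_prod e) = (\<Prod>i\<in>{1..t}. w i ^ (e i * f i))"
proof -
  let ?e = "SOME e'. exp_prod e' = exp_prod e"
  have "exp_prod ?e = exp_prod e"
    by (rule someI[of _ e]) (rule refl)
  then have "?e i mod n i = e i mod n i" if "i \<in> {1..t}" for i
    using exp_prod_eq_iff that by blast
  then have "w i ^ (?e i * f i) = w i ^ (e i * f i)" if "i \<in> {1..t}" for i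
    using primitive_root_pow_mod[OF prim[OF that]] that by (metis power_mult)
  then show ?thesis
    unfolding chi_def using exp_prod_closed by (auto intro!: prod.cong)
qed

lemma chi_linear: "chi f \<in> linear_characters Q"
proof (rule linear_characters_eqI)
  show "chi f \<in> extensional (carrier Q)"
    by (simp add: chi_def)
  have "w i \<noteq> 0" if "i \<in> {1..t}" for i
    using prim[OF that] by (auto simp: primitive_root_of_unity_def power_0_left)
  then have nonzero: "w i ^ k \<noteq> 0" if "i \<in> {1..t}" for i k
    using that by simp
  show "chi f x \<noteq> 0" if x: "x \<in> carrier Q" for x
  proof -
    obtain a where "x = exp_prod (\<lambda>i. digit n i a)"
      using exp_prod_surj[OF x] by blast
    then show ?thesis
      using nonzero by (simp add: chi_exp_prod prod_zero_iff del: power_eq_0_iff)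
  qed
  show "chi f (x \<otimes> y) = chi f x * chi f y" if x: "x \<in> carrier Q" and y: "y \<in> carrier Q" for x y
  proof -
    obtain a b where "x = exp_prod (\<lambda>i. digit n i a)" "y = exp_prod (\<lambda>i. digit n i b)"
      using exp_prod_surj[OF x] exp_prod_surj[OF y] by metis
    then show ?thesis
      by (simp add: chi_exp_prod exp_prod_mult add_mult_distrib power_add prod.distrib)
  qed
qed

lemma h_eq_exp_prod: "i \<in> {1..t} \<Longrightarrow> h i = exp_prod (\<lambda>j. if j = i then 1 else 0)"
proof -
  assume i: "i \<in> {1..t}"
  have "exp_prod (\<lambda>j. if j = i then 1 else 0) = finprod Q (\<lambda>j. if i = j then h j else \<one>) {1..t}"
    unfolding exp_prod_def using h_closed by (intro finprod_cong') auto
  then show ?thesis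
    using finprod_singleton[OF i, of h] h_closed by (auto simp: Pi_iff)
qed

lemma chi_h:
  assumes i: "i \<in> {1..t}"
  shows "chi f (h i) = w i ^ f i"
proof -
  have "chi f (h i) = (\<Prod>j\<in>{1..t}. if j = i then w j ^ f j else 1)"
    unfolding h_eq_exp_prod[OF i] chi_exp_prod by (intro prod.cong) auto
  then show ?thesis
    using i by simp
qed

text \<open>Since \<open>h i\<close> has order \<open>n i\<close>, its image is an
  \<open>n i\<close>-th root of unity and so a power of \<open>w i\<close>. These exponents form
  \<open>f\<close>, and the values on generators determine the character.\<close>

lemma linear_character_eq_chi:
  assumes \<chi>: "\<chi> \<in> linear_characters Q"
  obtains f where "\<chi> = chi f" "\<And>i. i \<in> {1..t} \<Longrightarrow> f i < n i"
proof -
  have "\<exists>m<n i. \<chi> (h i) = w i ^ m" if i: "i \<in> {1..t}" for i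
  proof (rule root_of_unity_eq_primitive_power[OF prim[OF i]])
    have "\<chi> (h i) ^ n i = \<chi> (h i [^] n i)"
      using linear_character_pow[OF \<chi> h_closed[OF i]] by simp
    also have "\<dots> = 1"
      using pow_ord_eq_1[OF h_closed[OF i]] ord_h[OF i] linear_character_one[OF \<chi>] by simp
    finally show "\<chi> (h i) ^ n i = 1" .
  qed
  then obtain f where f: "\<And>i. i \<in> {1..t} \<Longrightarrow> f i < n i \<and> \<chi> (h i) = w i ^ f i"
    by metis
  have "\<chi> x = chi f x" for x
  proof (cases "x \<in> carrier Q")
    case True
    then obtain a where "x = exp_prod (\<lambda>i. digit n i a)"
      using exp_prod_surj by blast
    moreover have "\<chi> (exp_prod e) = chi f (exp_prod e)" for e
    proof -
      have "\<chi> (exp_prod e) = (\<Prod>i\<in>{1..t}. \<chi> (h i [^] e i))"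
        unfolding exp_prod_def using h_closed by (intro linear_character_finprod[OF \<chi>]) auto
      also have "\<dots> = (\<Prod>i\<in>{1..t}. w i ^ (e i * f i))"
        using f h_closed
        by (intro prod.cong) (auto simp: linear_character_pow[OF \<chi>] mult.commute simp flip: power_mult)
      finally show ?thesis
        by (simp add: chi_exp_prod)
    qed
    ultimately show ?thesis
      by simp
  next
    case False
    then show ?thesis
      using extensional_arb[OF linear_charactersD(1)[OF \<chi>] False]
        extensional_arb[OF linear_charactersD(1)[OF chi_linear[of f]] False] by simp
  qed
  then have "\<chi> = chi f"
    by (rule ext)
  then show ?thesis
    by (rule that) (use f in blast)
qed

section \<open>Rows of the iterated Fourier matrix as characters\<close>

definition row_character :: "nat \<Rightarrow> 'a \<Rightarrow> complex" where
  "row_character b = chi (\<lambda>i. digit n i b)"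

abbreviation P :: "complex mat" where "P \<equiv> iterated_fourier_mat n w t"

lemma row_character_linear: "row_character b \<in> linear_characters Q"
  unfolding row_character_def by (rule chi_linear)

text \<open>The \<open>b\<close>-th listed element has the digits of \<open>b\<close> as exponents,
  so evaluating the character there gives the entry formula of \<open>P\<close>.\<close>

lemma row_character_xs:
  assumes "a < N" "b < N"
  shows "row_character a (xs ! b) = P $$ (a, b)"
  using assms
  by (simp add: row_character_def nth_xs chi_exp_prod iterated_fourier_mat_index mult.commute)

lemma P_sym: "a < N \<Longrightarrow> b < N \<Longrightarrow> P $$ (a, b) = P $$ (b, a)"
  by (simp add: iterated_fourier_mat_index mult.commute)

lemma bij_betw_row_character: "bij_betw row_character {..<N} (linear_characters Q)"
proof (rule bij_betw_imageI)
  show "inj_on row_character {..<N}"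
  proof (rule inj_onI)
    fix a b assume ab: "a \<in> {..<N}" "b \<in> {..<N}" and eq: "row_character a = row_character b"
    have "digit n i a = digit n i b" if i: "i \<in> {1..t}" for i
    proof -
      \<comment> \<open>Evaluation at the generator \<open>h i\<close> isolates digit
        \<open>i\<close> of the row index.\<close>
      have "w i ^ digit n i a = w i ^ digit n i b"
        using fun_cong[OF eq, of "h i"] unfolding row_character_def chi_h[OF i] .
      then show ?thesis
        by (rule inj_onD[OF primitive_root_inj_on[OF prim[OF i]]]) (auto intro!: digit_less n_pos i)
    qed
    then show "a = b"
      using ab by (intro digits_inj[of a n t b]) auto
  qed
  have "\<chi> \<in> row_character ` {..<N}" if \<chi>: "\<chi> \<in> linear_characters Q" for \<chi>
  proof -
    obtain f where f: "\<chi> = chi f" "\<And>i. i \<in> {1..t} \<Longrightarrow> f i < n i"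
      using linear_character_eq_chi[OF \<chi>] by blast
    \<comment> \<open>The row index is found by reading the exponents \<open>f\<close> of the
      character as exponents of a group element: the position of that element in the listing has
      digits \<open>f\<close>.\<close>
    obtain a where a: "a < N" "exp_prod f = exp_prod (\<lambda>i. digit n i a)"
      using exp_prod_surj[OF exp_prod_closed] by blast
    have "f i = digit n i a" if i: "i \<in> {1..t}" for i
    proof -
      have "f i mod n i = digit n i a mod n i"
        using a(2) i unfolding exp_prod_eq_iff by blast
      then show ?thesis
        using f(2)[OF i] digit_less[of n i a] n_pos[OF i] by simp
    qed
    then have "chi f = row_character a"
      unfolding chi_def row_character_def by (auto intro!: prod.cong)
    then show ?thesis
      using a(1) f(1) by auto
  qed
  then show "row_character ` {..<N} = linear_characters Q"
    using row_character_linear by auto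
qed

section \<open>Root of unity entries, the product with the adjoint, and the inverse\<close>

lemma P_carrier: "P \<in> carrier_mat N N"
  by (rule iterated_fourier_mat_carrier)

lemma P_root_of_unity:
  assumes "a < N" "b < N"
  shows "\<exists>m>0. P $$ (a, b) ^ m = 1"
proof (intro exI conjI)
  show "0 < Coset.order Q"
    using fin by (simp add: order_gt_0_iff_finite)
  have x: "xs ! b \<in> carrier Q"
    using assms set_xs length_xs nth_mem by metis
  have "row_character a (xs ! b) ^ Coset.order Q = row_character a (xs ! b [^] Coset.order Q)"
    using linear_character_pow[OF row_character_linear x] by simp
  then show "P $$ (a, b) ^ Coset.order Q = 1"
    using assms pow_order_eq_1[OF x] linear_character_one[OF row_character_linear]
    by (simp add: row_character_xs)
qed

text \<open>An entry of the product pairs two rows. Because the columns run once through the group,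
  this is the inner product of two characters, and distinct rows are distinct characters.\<close>

lemma P_mult_adjoint: "P * mat_adjoint P = of_nat N \<cdot>\<^sub>m 1\<^sub>m N"
proof (rule eq_matI)
  fix a b assume "a < dim_row (of_nat N \<cdot>\<^sub>m 1\<^sub>m N :: complex mat)"
    "b < dim_col (of_nat N \<cdot>\<^sub>m 1\<^sub>m N :: complex mat)"
  then have ab: "a < N" "b < N" by auto
  have "(P * mat_adjoint P) $$ (a, b) = (\<Sum>k<N. P $$ (a, k) * cnj (P $$ (b, k)))"
    using P_carrier ab
    by (simp add: mat_adjoint_def scalar_prod_def mat_of_rows_def atLeast0LessThan P_sym)
  also have "\<dots> = (\<Sum>k<N. row_character a (xs ! k) * cnj (row_character b (xs ! k)))"
    using ab by (intro sum.cong) (auto simp: row_character_xs)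
  also have "\<dots> = (\<Sum>x\<in>carrier Q. row_character a x * cnj (row_character b x))"
    by (rule sum.reindex_bij_betw[OF bij_betw_xs])
  also have "\<dots> = (if a = b then of_nat N else 0)"
    using linear_characters_orthogonal[OF fin row_character_linear row_character_linear]
      bij_betw_row_character ab by (auto simp: order_eq bij_betw_def dest: inj_onD)
  finally show "(P * mat_adjoint P) $$ (a, b) = (of_nat N \<cdot>\<^sub>m 1\<^sub>m N) $$ (a, b)"
    using ab by simp
qed (use P_carrier in \<open>auto simp: mat_adjoint_def\<close>)

text \<open>The adjoint divided by \<open>N\<close> is a right inverse, and for square matrices a
  right inverse is also a left inverse.\<close>

lemma P_inverse:
  obtains R where "R \<in> carrier_mat N N" "P * R = 1\<^sub>m N" "R * P = 1\<^sub>m N"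
proof -
  let ?R = "(1 / of_nat N) \<cdot>\<^sub>m mat_adjoint P"
  have adj: "mat_adjoint P \<in> carrier_mat N N"
    using P_carrier by (auto simp: mat_adjoint_def)
  have "N \<noteq> 0"
    using n_pos by (metis finite_atLeastAtMost less_irrefl prod_zero_iff)
  have "P * ?R = (1 / of_nat N) \<cdot>\<^sub>m (P * mat_adjoint P)"
    using P_carrier adj by (rule mult_smult_distrib)
  also have "\<dots> = 1\<^sub>m N"
    unfolding P_mult_adjoint using \<open>N \<noteq> 0\<close> by (intro eq_matI) auto
  finally have "P * ?R = 1\<^sub>m N" .
  moreover have "?R \<in> carrier_mat N N"
    using adj by simp
  ultimately show ?thesis
    using that mat_mult_left_right_inverse[OF P_carrier] by blast
qed

section \<open>Eigenvectors and diagonalization of group ring matrices\<close>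

lemma group_ring_mat_mult_P:
  assumes a: "a < N" and b: "b < N"
  shows "(\<Sum>k<N. group_ring_mat Q xs \<alpha> $$ (a, k) * P $$ (k, b))
    = P $$ (a, b) * (\<Sum>y\<in>carrier Q. \<alpha> y * row_character b y)"
proof -
  let ?x = "xs ! a"
  have x: "?x \<in> carrier Q"
    using a set_xs length_xs nth_mem by metis
  have bij: "bij_betw (\<lambda>y. ?x \<otimes> y) (carrier Q) (carrier Q)"
    by (rule bij_betwI[where g = "\<lambda>y. inv ?x \<otimes> y"]) (use x in \<open>auto simp flip: m_assoc\<close>)
  \<comment> \<open>Symmetry of \<open>P\<close> turns its column \<open>b\<close> into the values
    of \<open>row_character b\<close> along the listing.\<close>
  have "(\<Sum>k<N. group_ring_mat Q xs \<alpha> $$ (a, k) * P $$ (k, b))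
      = (\<Sum>k<N. \<alpha> (inv ?x \<otimes> xs ! k) * row_character b (xs ! k))"
    using a b by (intro sum.cong) (auto simp: group_ring_mat_def length_xs row_character_xs P_sym[of _ b])
  also have "\<dots> = (\<Sum>y\<in>carrier Q. \<alpha> (inv ?x \<otimes> y) * row_character b y)"
    by (rule sum.reindex_bij_betw[OF bij_betw_xs])
  \<comment> \<open>Translation by the row label cancels the inverse inside \<open>\<alpha>\<close>;
    multiplicativity then lets the character value at \<open>?x\<close> leave the sum.\<close>
  also have "\<dots> = (\<Sum>y\<in>carrier Q. \<alpha> (inv ?x \<otimes> (?x \<otimes> y)) * row_character b (?x \<otimes> y))"
    by (rule sum.reindex_bij_betw[OF bij, symmetric])
  also have "\<dots> = (\<Sum>y\<in>carrier Q. row_character b ?x * (\<alpha> y * row_character b y))"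
    using x by (intro sum.cong)
      (auto simp: linear_charactersD(3)[OF row_character_linear] simp flip: m_assoc)
  finally show ?thesis
    using row_character_xs[OF b a] P_sym[OF a b] by (simp add: sum_distrib_left)
qed

text \<open>All digits of 0 vanish. With this normalization the eigenvalue can be read off from the
  first row of \<open>B\<close>.\<close>

lemma P_row_0:
  assumes "b < N"
  shows "P $$ (0, b) = 1"
proof -
  have "0 < N"
    using assms by (rule le_less_trans[OF le0])
  then show ?thesis
    by (simp only: iterated_fourier_mat_index[OF _ assms]) simp
qed

text \<open>The columns of \<open>P\<close> are eigenvectors, so \<open>B * P = P * ?D\<close>;
  multiplying by the left inverse \<open>R\<close> leaves \<open>?D\<close>.\<close>

lemma diagonalization:
  assumes R: "R \<in> carrier_mat N N" "R * P = 1\<^sub>m N" and B: "B \<in> group_ring_matrices Q xs"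
  shows "R * B * P = mat N N (\<lambda>(i, j). if i = j then \<Sum>k<N. B $$ (0, k) * P $$ (k, j) else 0)"
    (is "_ = ?D")
proof -
  obtain \<alpha> where \<alpha>: "B = group_ring_mat Q xs \<alpha>"
    using B by (auto simp: group_ring_matrices_def)
  have Bc: "B \<in> carrier_mat N N"
    by (simp add: \<alpha> group_ring_mat_def length_xs)
  have "B * P = P * ?D"
  proof (rule eq_matI)
    fix a b assume "a < dim_row (P * ?D)" "b < dim_col (P * ?D)"
    then have ab: "a < N" "b < N"
      using P_carrier by auto
    have "0 < N"
      using ab(1) by (rule le_less_trans[OF le0])
    have "(B * P) $$ (a, b) = (\<Sum>k<N. B $$ (a, k) * P $$ (k, b))"
      using ab Bc P_carrier by (simp add: scalar_prod_def atLeast0LessThan)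
    \<comment> \<open>The eigenvector equation is used at row \<open>a\<close> and at row 0. The
      latter, where the entry of \<open>P\<close> is 1, replaces the eigenvalue in terms of
      \<open>\<alpha>\<close> by an expression in the first row of \<open>B\<close>.\<close>
    also have "\<dots> = P $$ (a, b) * (\<Sum>k<N. B $$ (0, k) * P $$ (k, b))"
      unfolding \<alpha> group_ring_mat_mult_P[OF ab] group_ring_mat_mult_P[OF \<open>0 < N\<close> ab(2)]
      by (simp add: P_row_0[OF ab(2)])
    also have "\<dots> = (P * ?D) $$ (a, b)"
      using ab P_carrier
      by (simp add: scalar_prod_def atLeast0LessThan if_distrib[of "\<lambda>x. _ * x"] cong: if_cong)
    finally show "(B * P) $$ (a, b) = (P * ?D) $$ (a, b)" .
  qed (use Bc P_carrier in auto)
  then have "R * B * P = (R * P) * ?D"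
    using R(1) Bc P_carrier by (simp add: assoc_mult_mat[of _ N N _ N _ N])
  then show ?thesis
    unfolding R(2) by simp
qed

text \<open>For an abelian group the classes are single elements and the irreducible characters are
  the linear ones, so the rows and the listing already have the right labels.\<close>

lemma character_table: "is_character_table Q xs P"
proof -
  have "bij_betw (\<lambda>j. conjugacy_class Q (xs ! j)) {..<N} (conjugacy_class Q ` carrier Q)"
  proof (rule bij_betw_trans[OF bij_betw_xs, of "conjugacy_class Q", unfolded comp_def])
    show "bij_betw (conjugacy_class Q) (carrier Q) (conjugacy_class Q ` carrier Q)"
      by (rule inj_on_imp_bij_betw) (auto simp: inj_on_def conjugacy_class_eq)
  qed
  moreover have "bij_betw row_character {..<N} (irreducible_characters Q)"
    using bij_betw_row_character irreducible_characters_comm_group[OF comm_group_axioms] by simp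
  ultimately show ?thesis
    unfolding is_character_table_def using P_carrier row_character_xs
    by (auto simp: set_xs length_xs intro!: exI[of _ row_character])
qed

end

theorem mainTheorem3:
  fixes Q :: "('a, 'b) monoid_scheme"
    and q t :: nat
    and n :: "nat \<Rightarrow> nat"
    and h :: "nat \<Rightarrow> 'a"
  assumes "comm_group Q"
    and "finite (carrier Q)"
    and "Coset.order Q = q"
    and "1 \<le> t"
    and "cyclic_decomposition Q t n h"
  shows
    "(\<exists>w. \<forall>i\<in>{1..t}. primitive_root_of_unity (n i) (w i)) \<and>
     (\<forall>w. (\<forall>i\<in>{1..t}. primitive_root_of_unity (n i) (w i)) \<longrightarrow>
       (let xs = cyclic_listing Q n h t; P = iterated_fourier_mat n w t in
          distinct xs \<and> set xs = carrier Q \<and>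
          P \<in> carrier_mat q q \<and>
          (\<exists>R\<in>carrier_mat q q. inverts_mat P R \<and> inverts_mat R P \<and>
             (\<forall>B\<in>group_ring_matrices Q xs.
                diagonal_mat (R * B * P) \<and>
                (\<forall>j<q. (R * B * P) $$ (j, j) = (\<Sum>k<q. B $$ (0, k) * P $$ (k, j))))) \<and>
          (\<forall>i<q. \<forall>j<q. \<exists>m>0. P $$ (i, j) ^ m = 1) \<and>
          P * mat_adjoint P = of_nat q \<cdot>\<^sub>m 1\<^sub>m q \<and>
          (\<exists>\<chi>. bij_betw \<chi> {..<q} (linear_characters Q) \<and>
               (\<forall>i<q. \<forall>j<q. row P i $ j = \<chi> i (xs ! j))) \<and>
          is_character_table Q xs P))"
proof -
  interpret cyclic_product Q t n h
    using assms by (simp add: cyclic_product_def cyclic_product_axioms_def)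
  have q: "q = N"
    using assms(3) order_eq by simp
  \<comment> \<open>Ensures that the statement about all choices of primitive roots is not
    vacuous.\<close>
  have roots: "\<exists>w. \<forall>i\<in>{1..t}. primitive_root_of_unity (n i) (w i)"
    using primitive_root_of_unity_exists n_pos by (intro bchoice) blast
  have main: "distinct xs \<and> set xs = carrier Q \<and>
      P \<in> carrier_mat q q \<and>
      (\<exists>R\<in>carrier_mat q q. inverts_mat P R \<and> inverts_mat R P \<and>
         (\<forall>B\<in>group_ring_matrices Q xs.
            diagonal_mat (R * B * P) \<and>
            (\<forall>j<q. (R * B * P) $$ (j, j) = (\<Sum>k<q. B $$ (0, k) * P $$ (k, j))))) \<and>
      (\<forall>i<q. \<forall>j<q. \<exists>m>0. P $$ (i, j) ^ m = 1) \<and>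
      P * mat_adjoint P = of_nat q \<cdot>\<^sub>m 1\<^sub>m q \<and>
      (\<exists>\<chi>. bij_betw \<chi> {..<q} (linear_characters Q) \<and>
           (\<forall>i<q. \<forall>j<q. row P i $ j = \<chi> i (xs ! j))) \<and>
      is_character_table Q xs P"
    if w: "\<forall>i\<in>{1..t}. primitive_root_of_unity (n i) (w i)" and P: "P = iterated_fourier_mat n w t"
    for w P
  proof -
    interpret cyclic_product_roots Q t n h w
      using w by unfold_locales auto
    obtain R where R: "R \<in> carrier_mat N N" "P * R = 1\<^sub>m N" "R * P = 1\<^sub>m N"
      using P_inverse P by blast
    have "diagonal_mat (R * B * P) \<and>
        (\<forall>j<q. (R * B * P) $$ (j, j) = (\<Sum>k<q. B $$ (0, k) * P $$ (k, j)))"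
      if "B \<in> group_ring_matrices Q xs" for B
      using diagonalization[OF R(1) _ that] R(3) by (auto simp: P q diagonal_mat_def)
    moreover have "inverts_mat P R" "inverts_mat R P"
      using R P_carrier by (auto simp: inverts_mat_def P)
    moreover have "\<forall>i<q. \<forall>j<q. row P i $ j = row_character i (xs ! j)"
      using P_carrier by (auto simp: P q row_character_xs)
    ultimately show ?thesis
      using distinct_xs set_xs P_carrier P_root_of_unity P_mult_adjoint bij_betw_row_character
        character_table R(1)
      unfolding P q by blast
  qed
  show ?thesis
    unfolding Let_def
    by (rule conjI[OF roots], intro allI impI, rule main[OF _ refl])
qed

end
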